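(* Let $(\mathcal{A};\mathcal{WE})$ be a weak exact category and let $(\mathcal{I},\mathcal{J})$ be a complete ideal torsion pair in $(\mathcal{A};\mathcal{WE})$. If $\mathcal{I}$ is a covering ideal closed under weak extensions, then $\mathcal{J}$ is an object ideal.
   Context: Additive categories have finite coproducts. An ideal of an additive category $\mathcal{A}$ is an additive subbifunctor of $\mathrm{Hom}(-,-)$. An ideal $\mathcal{J}$ is an object ideal if every morphism of $\mathcal{J}$ factors through an object $X$ with $1_X\in\mathcal{J}$. For a collection $\mathcal{M}$ of morphisms, $\mathcal{M}^{\perp}$ is the ideal of all $j$ with $jxf=0$ for every $f\in\mathcal{M}$ and every morphism $x$ from the codomain of $f$ to the domain of $j$; ${}^{\perp}\mathcal{M}$ is defined dually. A pair $(\mathcal{I},\mathcal{J})$ of ideals is an ideal torsion pair if $\mathcal{I}={}^{\perp}\mathcal{J}$ and $\mathcal{J}=\mathcal{I}^{\perp}$. A weak kernel of $g\colon Y\to Z$ is a morphism $k\colon X\to Y$ with $gk=0$ such that every $k'$ with $gk'=0$ factors (not necessarily uniquely) through $k$; weak cokernels are dual. A weak kernel-cokernel pair is a composable pair $X\xrightarrow{k}Y\xrightarrow{c}Z$ with $k$ a weak kernel of $c$ and $c$ a weak cokernel of $k$; these form an additive category with morphisms the commutative ladders. A weak kernel-cokernel category is an additive category $\mathcal{A}$ with a collection of weak kernel-cokernel pairs (called weak conflations) forming an additive subcategory (in particular closed under finite coproducts) closed under isomorphism and containing $A\xrightarrow{1_A}A\to0$ and $0\to A\xrightarrow{1_A}A$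 for all $A$. In a weak conflation $(k,c)$, $k$ is called a weak inflation and $c$ a weak deflation. A weak exact category $(\mathcal{A};\mathcal{WE})$ is a weak kernel-cokernel category such that weak inflations are closed under composition, weak deflations are closed under composition, and (Five Lemma) for every commutative ladder $(f,g,h)$ between two weak conflations, if two of $f,g,h$ are isomorphisms then so is the third. A morphism $e\colon F\to T$ is a weak extension $e=i\star j$ of $j$ by $i$ if there are a weak conflation $X\xrightarrow{k}Y\xrightarrow{c}Z$ and morphisms $e^2\colon F\to Y$, $e^1\colon Y\to T$ with $e=e^1e^2$, $ce^2=j$ and $e^1k=i$. For ideals $\mathcal{I},\mathcal{J}$, $\mathcal{I}\diamond\mathcal{J}$ is the ideal of all weak extensions $i\star j$ with $i\in\mathcal{I}$, $j\in\mathcal{J}$. $\mathcal{I}$ is closed under weak extensions if $\mathcal{I}\diamond\mathcal{I}=\mathcal{I}$. An $\mathcal{I}$-precover of $X$ is a morphism $i\colon T\to X$ in $\mathcal{I}$ through which every morphism in $\mathcal{I}$ with codomain $X$ factors; it is Hom-special if it is a weak inflation; it is an $\mathcal{I}$-cover if every $f\colon T\to T$ with $if=i$ is an isomorphism. $\mathcal{I}$ is covering if every object has an $\mathcal{I}$-cover. $\mathcal{J}$-preenvelopes are dual to precovers, and are Hom-special if they are weak deflations. An ideal torsion pair $(\mathcal{I},\mathcal{J})$ is complete if every object has a Hom-special $\mathcal{I}$-precover, equivalently every object has a Hom-special $\mathcal{J}$-preenvelope. *)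

theory Defs
  imports "HOL-Algebra.Group"
begin

section \<open>Additive categories\<close>

text \<open>
  Categories are arrow-based: every arrow determines its domain and codomain, so a collection of
  morphisms is just a set of arrows. \<open>Comp g f\<close> (written \<open>g \<cdot> f\<close>) is "first \<open>f\<close>, then \<open>g\<close>".
\<close>

record ('o, 'm) acat =
  Ob :: "'o set"
  Arr :: "'m set"
  Dom :: "'m \<Rightarrow> 'o"
  Cod :: "'m \<Rightarrow> 'o"
  Ident :: "'o \<Rightarrow> 'm"
  Comp :: "'m \<Rightarrow> 'm \<Rightarrow> 'm"  (infixr "\<cdot>\<index>" 70)
  Plus :: "'m \<Rightarrow> 'm \<Rightarrow> 'm"
  Zero :: "'o \<Rightarrow> 'o \<Rightarrow> 'm"

definition Hom :: "('o, 'm) acat \<Rightarrow> 'o \<Rightarrow> 'o \<Rightarrow> 'm set" where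
  "Hom C A B = {f \<in> Arr C. Dom C f = A \<and> Cod C f = B}"

definition hom_group :: "('o, 'm) acat \<Rightarrow> 'o \<Rightarrow> 'o \<Rightarrow> 'm monoid" where
  "hom_group C A B = \<lparr>carrier = Hom C A B, monoid.mult = Plus C, one = Zero C A B\<rparr>"

definition is_iso :: "('o, 'm) acat \<Rightarrow> 'm \<Rightarrow> bool" where
  "is_iso C f \<longleftrightarrow> f \<in> Arr C \<and>
     (\<exists>g \<in> Hom C (Cod C f) (Dom C f).
        Comp C g f = Ident C (Dom C f) \<and> Comp C f g = Ident C (Cod C f))"

definition isomorphic :: "('o, 'm) acat \<Rightarrow> 'o \<Rightarrow> 'o \<Rightarrow> bool" where
  "isomorphic C A B \<longleftrightarrow> (\<exists>f \<in> Hom C A B. is_iso C f)"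

definition zero_object :: "('o, 'm) acat \<Rightarrow> 'o \<Rightarrow> bool" where
  "zero_object C Z \<longleftrightarrow> Z \<in> Ob C \<and>
     (\<forall>A \<in> Ob C. (\<exists>!f. f \<in> Hom C A Z) \<and> (\<exists>!f. f \<in> Hom C Z A))"

definition is_coproduct ::
  "('o, 'm) acat \<Rightarrow> 'i set \<Rightarrow> ('i \<Rightarrow> 'o) \<Rightarrow> 'o \<Rightarrow> ('i \<Rightarrow> 'm) \<Rightarrow> bool" where
  "is_coproduct C K X S \<iota> \<longleftrightarrow>
     S \<in> Ob C \<and> (\<forall>i \<in> K. X i \<in> Ob C \<and> \<iota> i \<in> Hom C (X i) S) \<and>
     (\<forall>T \<in> Ob C. \<forall>f. (\<forall>i \<in> K. f i \<in> Hom C (X i) T) \<longrightarrow>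
        (\<exists>!h. h \<in> Hom C S T \<and> (\<forall>i \<in> K. Comp C h (\<iota> i) = f i)))"

locale preadditive_category =
  fixes C :: "('o, 'm) acat" (structure)
  assumes Dom_Ob: "f \<in> Arr C \<Longrightarrow> Dom C f \<in> Ob C"
    and Cod_Ob: "f \<in> Arr C \<Longrightarrow> Cod C f \<in> Ob C"
    and Ident_Hom: "A \<in> Ob C \<Longrightarrow> Ident C A \<in> Hom C A A"
    and Comp_Hom: "\<lbrakk>f \<in> Hom C A B; g \<in> Hom C B D\<rbrakk> \<Longrightarrow> g \<cdot> f \<in> Hom C A D"
    and Comp_Ident_left: "f \<in> Hom C A B \<Longrightarrow> Ident C B \<cdot> f = f"
    and Comp_Ident_right: "f \<in> Hom C A B \<Longrightarrow> f \<cdot> Ident C A = f"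
    and Comp_assoc: "\<lbrakk>f \<in> Hom C A B; g \<in> Hom C B D; h \<in> Hom C D E\<rbrakk>
          \<Longrightarrow> (h \<cdot> g) \<cdot> f = h \<cdot> (g \<cdot> f)"
    and Hom_comm_group: "\<lbrakk>A \<in> Ob C; B \<in> Ob C\<rbrakk> \<Longrightarrow> comm_group (hom_group C A B)"
    and Comp_Plus_right: "\<lbrakk>f \<in> Hom C A B; f' \<in> Hom C A B; g \<in> Hom C B D\<rbrakk>
          \<Longrightarrow> g \<cdot> Plus C f f' = Plus C (g \<cdot> f) (g \<cdot> f')"
    and Comp_Plus_left: "\<lbrakk>f \<in> Hom C A B; g \<in> Hom C B D; g' \<in> Hom C B D\<rbrakk>
          \<Longrightarrow> Plus C g g' \<cdot> f = Plus C (g \<cdot> f) (g' \<cdot> f)"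

text \<open>The case \<open>n = 0\<close> of the axiom below provides the zero object.\<close>

locale additive_category = preadditive_category +
  assumes finite_coproducts: "(\<forall>i < n. X i \<in> Ob C) \<Longrightarrow> \<exists>S \<iota>. is_coproduct C {..<n::nat} X S \<iota>"


section \<open>Ideals and ideal torsion pairs\<close>

definition cat_ideal :: "('o, 'm) acat \<Rightarrow> 'm set \<Rightarrow> bool" where
  "cat_ideal C I \<longleftrightarrow> I \<subseteq> Arr C \<and>
     (\<forall>A \<in> Ob C. \<forall>B \<in> Ob C. subgroup (I \<inter> Hom C A B) (hom_group C A B)) \<and>
     (\<forall>f \<in> I. \<forall>g \<in> Arr C. Dom C g = Cod C f \<longrightarrow> Comp C g f \<in> I) \<and>
     (\<forall>f \<in> I. \<forall>g \<in> Arr C. Cod C g = Dom C f \<longrightarrow> Comp C f g \<in> I)"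

definition object_ideal :: "('o, 'm) acat \<Rightarrow> 'm set \<Rightarrow> bool" where
  "object_ideal C I \<longleftrightarrow> cat_ideal C I \<and>
     (\<forall>f \<in> I. \<exists>X \<in> Ob C. Ident C X \<in> I \<and>
        (\<exists>g \<in> Hom C (Dom C f) X. \<exists>h \<in> Hom C X (Cod C f). f = Comp C h g))"

definition right_perp :: "('o, 'm) acat \<Rightarrow> 'm set \<Rightarrow> 'm set" where
  "right_perp C M = {j \<in> Arr C. \<forall>f \<in> M. \<forall>x \<in> Hom C (Cod C f) (Dom C j).
     Comp C j (Comp C x f) = Zero C (Dom C f) (Cod C j)}"

definition left_perp :: "('o, 'm) acat \<Rightarrow> 'm set \<Rightarrow> 'm set" where
  "left_perp C M = {i \<in> Arr C. \<forall>f \<in> M. \<forall>x \<in> Hom C (Cod C i) (Dom C f).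
     Comp C f (Comp C x i) = Zero C (Dom C i) (Cod C f)}"

definition ideal_torsion_pair :: "('o, 'm) acat \<Rightarrow> 'm set \<Rightarrow> 'm set \<Rightarrow> bool" where
  "ideal_torsion_pair C I J \<longleftrightarrow>
     cat_ideal C I \<and> cat_ideal C J \<and> I = left_perp C J \<and> J = right_perp C I"

definition precover :: "('o, 'm) acat \<Rightarrow> 'm set \<Rightarrow> 'o \<Rightarrow> 'm \<Rightarrow> bool" where
  "precover C I X i \<longleftrightarrow> i \<in> I \<and> i \<in> Arr C \<and> Cod C i = X \<and>
     (\<forall>f \<in> I. Cod C f = X \<longrightarrow> (\<exists>g \<in> Hom C (Dom C f) (Dom C i). f = Comp C i g))"

definition cover :: "('o, 'm) acat \<Rightarrow> 'm set \<Rightarrow> 'o \<Rightarrow> 'm \<Rightarrow> bool" where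
  "cover C I X i \<longleftrightarrow> precover C I X i \<and>
     (\<forall>f \<in> Hom C (Dom C i) (Dom C i). Comp C i f = i \<longrightarrow> is_iso C f)"

definition covering_ideal :: "('o, 'm) acat \<Rightarrow> 'm set \<Rightarrow> bool" where
  "covering_ideal C I \<longleftrightarrow> cat_ideal C I \<and> (\<forall>X \<in> Ob C. \<exists>i. cover C I X i)"


section \<open>Weak kernel-cokernel pairs\<close>

definition weak_kernel :: "('o, 'm) acat \<Rightarrow> 'm \<Rightarrow> 'm \<Rightarrow> bool" where
  "weak_kernel C k g \<longleftrightarrow> g \<in> Arr C \<and> k \<in> Arr C \<and> Cod C k = Dom C g \<and>
     Comp C g k = Zero C (Dom C k) (Cod C g) \<and>
     (\<forall>k' \<in> Arr C. Cod C k' = Dom C g \<and> Comp C g k' = Zero C (Dom C k') (Cod C g) \<longrightarrow>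
        (\<exists>l \<in> Hom C (Dom C k') (Dom C k). k' = Comp C k l))"

definition weak_cokernel :: "('o, 'm) acat \<Rightarrow> 'm \<Rightarrow> 'm \<Rightarrow> bool" where
  "weak_cokernel C c f \<longleftrightarrow> f \<in> Arr C \<and> c \<in> Arr C \<and> Dom C c = Cod C f \<and>
     Comp C c f = Zero C (Dom C f) (Cod C c) \<and>
     (\<forall>c' \<in> Arr C. Dom C c' = Cod C f \<and> Comp C c' f = Zero C (Dom C f) (Cod C c') \<longrightarrow>
        (\<exists>l \<in> Hom C (Cod C c) (Cod C c'). c' = Comp C l c))"

definition wkc_pair :: "('o, 'm) acat \<Rightarrow> 'm \<times> 'm \<Rightarrow> bool" where
  "wkc_pair C = (\<lambda>(k, c). weak_kernel C k c \<and> weak_cokernel C c k)"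

definition ladder :: "('o, 'm) acat \<Rightarrow> 'm \<times> 'm \<Rightarrow> 'm \<times> 'm \<Rightarrow> 'm \<Rightarrow> 'm \<Rightarrow> 'm \<Rightarrow> bool" where
  "ladder C = (\<lambda>(k, c) (k', c') f g h.
     f \<in> Hom C (Dom C k) (Dom C k') \<and> g \<in> Hom C (Cod C k) (Cod C k') \<and>
     h \<in> Hom C (Cod C c) (Cod C c') \<and>
     Comp C k' f = Comp C g k \<and> Comp C c' g = Comp C h c)"

text \<open>
  The category of weak kernel-cokernel pairs: an arrow \<open>(P, Q, f, g, h)\<close> is the commutative
  ladder \<open>(f, g, h)\<close> from the pair \<open>P\<close> to the pair \<open>Q\<close>, tagged with its domain and codomain.
\<close>

definition wkc_cat ::
  "('o, 'm) acat \<Rightarrow> ('m \<times> 'm, ('m \<times> 'm) \<times> ('m \<times> 'm) \<times> 'm \<times> 'm \<times> 'm) acat" where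
  "wkc_cat C = \<lparr>
     Ob = {P. wkc_pair C P},
     Arr = {(P, Q, f, g, h). wkc_pair C P \<and> wkc_pair C Q \<and> ladder C P Q f g h},
     Dom = (\<lambda>(P, Q, f, g, h). P),
     Cod = (\<lambda>(P, Q, f, g, h). Q),
     Ident = (\<lambda>(k, c). ((k, c), (k, c),
        Ident C (Dom C k), Ident C (Cod C k), Ident C (Cod C c))),
     Comp = (\<lambda>(P', Q', f', g', h') (P, Q, f, g, h).
        (P, Q', Comp C f' f, Comp C g' g, Comp C h' h)),
     Plus = (\<lambda>(P', Q', f', g', h') (P, Q, f, g, h).
        (P', Q', Plus C f' f, Plus C g' g, Plus C h' h)),
     Zero = (\<lambda>(k, c) (k', c'). ((k, c), (k', c'),
        Zero C (Dom C k) (Dom C k'), Zero C (Cod C k) (Cod C k'), Zero C (Cod C c) (Cod C c')))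
   \<rparr>"


section \<open>Weak exact categories\<close>

text \<open>
  The weak conflations \<open>WE\<close> span a full subcategory of \<^term>\<open>wkc_cat C\<close>, so being an additive
  subcategory means being closed under the finite coproducts of \<^term>\<open>wkc_cat C\<close>.
\<close>

locale weak_kc_category = additive_category C
  for C :: "('o, 'm) acat" (structure) +
  fixes WE :: "('m \<times> 'm) set"
  assumes WE_wkc: "WE \<subseteq> Ob (wkc_cat C)"
    and WE_coproduct:
      "\<lbrakk>\<forall>i < n. F i \<in> WE; is_coproduct (wkc_cat C) {..<n::nat} F S \<iota>\<rbrakk> \<Longrightarrow> S \<in> WE"
    and WE_iso: "\<lbrakk>P \<in> WE; Q \<in> Ob (wkc_cat C); isomorphic (wkc_cat C) P Q\<rbrakk> \<Longrightarrow> Q \<in> WE"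
    and WE_Ident_Zero: "\<lbrakk>A \<in> Ob C; zero_object C Z\<rbrakk> \<Longrightarrow> (Ident C A, Zero C A Z) \<in> WE"
    and WE_Zero_Ident: "\<lbrakk>A \<in> Ob C; zero_object C Z\<rbrakk> \<Longrightarrow> (Zero C Z A, Ident C A) \<in> WE"

definition weak_inflation :: "('m \<times> 'm) set \<Rightarrow> 'm \<Rightarrow> bool" where
  "weak_inflation WE k \<longleftrightarrow> (\<exists>c. (k, c) \<in> WE)"

definition weak_deflation :: "('m \<times> 'm) set \<Rightarrow> 'm \<Rightarrow> bool" where
  "weak_deflation WE c \<longleftrightarrow> (\<exists>k. (k, c) \<in> WE)"

locale weak_exact_category = weak_kc_category +
  assumes weak_inflation_Comp:
      "\<lbrakk>weak_inflation WE k; weak_inflation WE k'; Cod C k = Dom C k'\<rbrakk>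
        \<Longrightarrow> weak_inflation WE (k' \<cdot> k)"
    and weak_deflation_Comp:
      "\<lbrakk>weak_deflation WE c; weak_deflation WE c'; Cod C c = Dom C c'\<rbrakk>
        \<Longrightarrow> weak_deflation WE (c' \<cdot> c)"
    and five_lemma:
      "\<lbrakk>P \<in> WE; Q \<in> WE; ladder C P Q f g h\<rbrakk> \<Longrightarrow>
        (is_iso C f \<and> is_iso C g \<longrightarrow> is_iso C h) \<and>
        (is_iso C f \<and> is_iso C h \<longrightarrow> is_iso C g) \<and>
        (is_iso C g \<and> is_iso C h \<longrightarrow> is_iso C f)"

text \<open>\<open>weak_extension C WE i j e\<close> states that \<open>e = i \<star> j\<close>, a weak extension of \<open>j\<close> by \<open>i\<close>.\<close>

definition weak_extension :: "('o, 'm) acat \<Rightarrow> ('m \<times> 'm) set \<Rightarrow> 'm \<Rightarrow> 'm \<Rightarrow> 'm \<Rightarrow> bool" where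
  "weak_extension C WE i j e \<longleftrightarrow> e \<in> Arr C \<and>
     (\<exists>k c. (k, c) \<in> WE \<and>
        (\<exists>e2 \<in> Hom C (Dom C e) (Cod C k). \<exists>e1 \<in> Hom C (Cod C k) (Cod C e).
           e = Comp C e1 e2 \<and> Comp C c e2 = j \<and> Comp C e1 k = i))"

definition diamond :: "('o, 'm) acat \<Rightarrow> ('m \<times> 'm) set \<Rightarrow> 'm set \<Rightarrow> 'm set \<Rightarrow> 'm set" where
  "diamond C WE I J = {e. \<exists>i \<in> I. \<exists>j \<in> J. weak_extension C WE i j e}"

definition closed_under_weak_extensions ::
  "('o, 'm) acat \<Rightarrow> ('m \<times> 'm) set \<Rightarrow> 'm set \<Rightarrow> bool" where
  "closed_under_weak_extensions C WE I \<longleftrightarrow> diamond C WE I I = I"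

definition Hom_special_precover ::
  "('o, 'm) acat \<Rightarrow> ('m \<times> 'm) set \<Rightarrow> 'm set \<Rightarrow> 'o \<Rightarrow> 'm \<Rightarrow> bool" where
  "Hom_special_precover C WE I X i \<longleftrightarrow> precover C I X i \<and> weak_inflation WE i"

definition complete_ideal_torsion_pair ::
  "('o, 'm) acat \<Rightarrow> ('m \<times> 'm) set \<Rightarrow> 'm set \<Rightarrow> 'm set \<Rightarrow> bool" where
  "complete_ideal_torsion_pair C WE I J \<longleftrightarrow> ideal_torsion_pair C I J \<and>
     (\<forall>X \<in> Ob C. \<exists>i. Hom_special_precover C WE I X i)"

end

theory Submission
  imports Defs
begin

text \<open>
  Let \<open>p : T \<rightarrow> X\<close> be a Hom-special \<open>I\<close>-precover with weak conflation \<open>(p, c)\<close>, \<open>c : X \<rightarrow> Z\<close>.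
  Every morphism of \<open>J\<close> out of \<open>X\<close> kills \<open>p\<close>, so it factors through \<open>c\<close>; it remains to see
  that \<open>1\<^sub>Z \<in> J\<close>, i.e. that a Hom-special \<open>I\<close>-precover \<open>f\<close> of \<open>Z\<close>, with weak conflation
  \<open>(f, d)\<close>, vanishes. Now \<open>d \<cdot> c\<close> is a weak deflation, say with weak conflation \<open>(k, d \<cdot> c)\<close>.
  Since \<open>c \<cdot> k\<close> factors through \<open>f\<close>, the morphism \<open>k\<close> is a weak extension of a morphism of \<open>I\<close>
  by \<open>p\<close>, so \<open>k \<in> I\<close>. Hence \<open>k\<close> factors through \<open>p\<close> and \<open>c \<cdot> k = 0\<close>, which gives \<open>h\<close> with
  \<open>c = h \<cdot> d \<cdot> c\<close>. The Five Lemma for \<open>(1, 1, h \<cdot> d)\<close> makes \<open>d\<close> a split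
  monomorphism, and \<open>d \<cdot> f = 0\<close> forces \<open>f = 0\<close>.
\<close>

context preadditive_category
begin

lemma HomI: "f \<in> Arr C \<Longrightarrow> f \<in> Hom C (Dom C f) (Cod C f)"
  by (simp add: Hom_def)

lemma HomD: "f \<in> Hom C A B \<Longrightarrow> f \<in> Arr C \<and> Dom C f = A \<and> Cod C f = B"
  by (simp add: Hom_def)

lemma Hom_Ob:
  assumes "f \<in> Hom C A B"
  shows "A \<in> Ob C" "B \<in> Ob C"
  using assms Dom_Ob Cod_Ob by (auto simp: Hom_def)

lemma Zero_Hom:
  assumes "A \<in> Ob C" "B \<in> Ob C"
  shows "Zero C A B \<in> Hom C A B"
proof -
  interpret comm_group "hom_group C A B" using Hom_comm_group[OF assms] .
  show ?thesis using one_closed by (simp add: hom_group_def)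
qed

lemma Plus_idem_imp_Zero:
  assumes "x \<in> Hom C A B" "Plus C x x = x"
  shows "x = Zero C A B"
proof -
  interpret comm_group "hom_group C A B"
    using Hom_comm_group Hom_Ob[OF assms(1)] by blast
  show ?thesis
    using assms r_cancel_one[of x x] by (simp add: hom_group_def)
qed

lemma Plus_Zero:
  assumes "A \<in> Ob C" "B \<in> Ob C"
  shows "Plus C (Zero C A B) (Zero C A B) = Zero C A B"
proof -
  interpret comm_group "hom_group C A B" using Hom_comm_group[OF assms] .
  show ?thesis using r_one[OF one_closed] by (simp add: hom_group_def)
qed

text \<open>Composition with \<open>g\<close> is additive, so the composite is idempotent under
  \<open>Plus\<close> and hence neutral in its Hom group.\<close>

lemma Comp_Zero_right:
  assumes "A \<in> Ob C" "g \<in> Hom C B D"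
  shows "g \<cdot> Zero C A B = Zero C A D"
proof -
  have z: "Zero C A B \<in> Hom C A B" "Plus C (Zero C A B) (Zero C A B) = Zero C A B"
    using assms Hom_Ob Zero_Hom Plus_Zero by blast+
  show ?thesis
    by (rule Plus_idem_imp_Zero)
      (use z assms Comp_Hom Comp_Plus_right[OF z(1) z(1) assms(2)] in auto)
qed

lemma Comp_Zero_left:
  assumes "D \<in> Ob C" "f \<in> Hom C A B"
  shows "Zero C B D \<cdot> f = Zero C A D"
proof -
  have z: "Zero C B D \<in> Hom C B D" "Plus C (Zero C B D) (Zero C B D) = Zero C B D"
    using assms Hom_Ob Zero_Hom Plus_Zero by blast+
  show ?thesis
    by (rule Plus_idem_imp_Zero)
      (use z assms Comp_Hom Comp_Plus_left[OF assms(2) z(1) z(1)] in auto)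
qed

lemma iso_Comp_Zero_imp_Zero:
  assumes "is_iso C g" "g \<in> Hom C B D" "f \<in> Hom C A B" "g \<cdot> f = Zero C A D"
  shows "f = Zero C A B"
proof -
  obtain g' where g': "g' \<in> Hom C D B" "g' \<cdot> g = Ident C B"
    using assms(1) HomD[OF assms(2)] by (auto simp: is_iso_def)
  have "f = (g' \<cdot> g) \<cdot> f" using g' Comp_Ident_left assms(3) by simp
  also have "\<dots> = g' \<cdot> Zero C A D" using Comp_assoc assms g'(1) by simp
  also have "\<dots> = Zero C A B" using Comp_Zero_right g'(1) Hom_Ob(1)[OF assms(3)] by blast
  finally show ?thesis .
qed

lemma is_iso_Ident: "A \<in> Ob C \<Longrightarrow> is_iso C (Ident C A)"
  using Ident_Hom[of A] Comp_Ident_left[of "Ident C A" A A] by (auto simp: is_iso_def Hom_def)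

lemma ideal_Comp_left:
  assumes "cat_ideal C I" "f \<in> I" "f \<in> Hom C A B" "g \<in> Hom C B D"
  shows "g \<cdot> f \<in> I"
  using assms by (auto simp: cat_ideal_def Hom_def)

lemma ideal_Comp_right:
  assumes "cat_ideal C I" "g \<in> I" "f \<in> Hom C A B" "g \<in> Hom C B D"
  shows "g \<cdot> f \<in> I"
  using assms by (auto simp: cat_ideal_def Hom_def)

text \<open>The orthogonality condition allows a morphism \<open>x\<close> between \<open>i\<close>
  and \<open>j\<close>; here \<open>x\<close> is the identity of \<open>B\<close>.\<close>

lemma right_perp_Comp_Zero:
  assumes "j \<in> right_perp C I" "i \<in> I" "i \<in> Hom C A B" "j \<in> Hom C B D"
  shows "j \<cdot> i = Zero C A D"
proof -
  have "Ident C B \<in> Hom C (Cod C i) (Dom C j)"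
    using assms(3,4) HomD Hom_Ob(2) Ident_Hom by metis
  then have "j \<cdot> Ident C B \<cdot> i = Zero C (Dom C i) (Cod C j)"
    using assms(1,2) by (simp add: right_perp_def)
  then show ?thesis
    using Comp_Ident_left[OF assms(3)] HomD[OF assms(3)] HomD[OF assms(4)] by simp
qed

lemma precover_factor:
  assumes "precover C I X i" "i \<in> Hom C T X" "f \<in> I" "f \<in> Hom C A X"
  obtains g where "g \<in> Hom C A T" "f = i \<cdot> g"
  using assms unfolding precover_def by (metis HomD)

end

context weak_kc_category
begin

lemma WE_D:
  assumes "(k, c) \<in> WE"
  shows "weak_kernel C k c" "weak_cokernel C c k"
  using assms WE_wkc by (auto simp: wkc_cat_def wkc_pair_def)

lemma WE_Hom:
  assumes "(k, c) \<in> WE"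
  shows "k \<in> Hom C (Dom C k) (Cod C k)" "c \<in> Hom C (Cod C k) (Cod C c)"
    "c \<cdot> k = Zero C (Dom C k) (Cod C c)"
  using WE_D[OF assms] by (auto simp: weak_kernel_def Hom_def)

lemma WE_kernel_factor:
  assumes "(k, c) \<in> WE" "f \<in> Hom C A (Cod C k)" "c \<cdot> f = Zero C A (Cod C c)"
  obtains l where "l \<in> Hom C A (Dom C k)" "f = k \<cdot> l"
  using WE_D[OF assms(1)] assms(2,3) unfolding weak_kernel_def by (metis HomD)

lemma WE_cokernel_factor:
  assumes "(k, c) \<in> WE" "f \<in> Hom C (Cod C k) A" "f \<cdot> k = Zero C (Dom C k) A"
  obtains l where "l \<in> Hom C (Cod C c) A" "f = l \<cdot> c"
  using WE_D[OF assms(1)] assms(2,3) unfolding weak_cokernel_def by (metis HomD)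

lemma Hom_special_precoverE:
  assumes "Hom_special_precover C WE I X p"
  obtains T Z c where "precover C I X p" "p \<in> I" "(p, c) \<in> WE"
    "p \<in> Hom C T X" "c \<in> Hom C X Z" "c \<cdot> p = Zero C T Z"
proof -
  obtain c where "(p, c) \<in> WE"
    using assms by (auto simp: Hom_special_precover_def weak_inflation_def)
  moreover have "precover C I X p" "p \<in> I" "Cod C p = X"
    using assms by (auto simp: Hom_special_precover_def precover_def)
  ultimately show thesis using that WE_Hom by blast
qed

text \<open>Any \<open>x \<cdot> g\<close> with \<open>g\<close> in \<open>I\<close> and target
  \<open>Z\<close> again lies in the ideal, so it factors through the precover \<open>f\<close> and
  vanishes with it.\<close>

lemma precover_Zero_imp_Ident_right_perp:
  assumes "cat_ideal C I" "precover C I Z f" "f \<in> Hom C T Z" "f = Zero C T Z"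
  shows "Ident C Z \<in> right_perp C I"
proof -
  have Z: "Z \<in> Ob C" using Hom_Ob assms(3) by blast
  have "Ident C Z \<cdot> (x \<cdot> g) = Zero C (Dom C g) Z"
    if g: "g \<in> I" and x: "x \<in> Hom C (Cod C g) Z" for g x
  proof -
    have gH: "g \<in> Hom C (Dom C g) (Cod C g)" using g assms(1) by (auto simp: cat_ideal_def Hom_def)
    have xg: "x \<cdot> g \<in> Hom C (Dom C g) Z" using Comp_Hom gH x by blast
    have "x \<cdot> g \<in> I" using ideal_Comp_left assms(1) g gH x by blast
    then obtain l where "l \<in> Hom C (Dom C g) T" "x \<cdot> g = f \<cdot> l"
      using precover_factor[OF assms(2,3)] xg by blast
    then have "x \<cdot> g = Zero C (Dom C g) Z"
      using Comp_Zero_left[OF Z] assms(4) by simp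
    then show ?thesis using Comp_Ident_left[OF xg] by simp
  qed
  then show ?thesis using HomD[OF Ident_Hom[OF Z]] by (auto simp: right_perp_def)
qed

end

context weak_exact_category
begin

text \<open>A weak cokernel need not be epic, so \<open>c\<close> cannot be cancelled to get
  \<open>g = 1\<close>. The Five Lemma, applied to a ladder with two identities and
  \<open>g\<close>, still gives invertibility.\<close>

lemma WE_cokernel_endo_iso:
  assumes "(k, c) \<in> WE" "g \<in> Hom C (Cod C c) (Cod C c)" "g \<cdot> c = c"
  shows "is_iso C g"
proof -
  note H = WE_Hom[OF assms(1)]
  have obs: "Dom C k \<in> Ob C" "Cod C k \<in> Ob C" using Hom_Ob[OF H(1)] .
  have "ladder C (k, c) (k, c) (Ident C (Dom C k)) (Ident C (Cod C k)) g"
    using assms H obs Ident_Hom Comp_Ident_left[OF H(1)] Comp_Ident_right[OF H(1)]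
      Comp_Ident_right[OF H(2)] by (simp add: ladder_def)
  then show ?thesis using five_lemma[OF assms(1) assms(1)] is_iso_Ident obs by blast
qed

text \<open>Supplies the vanishing precover from which
  \<open>precover_Zero_imp_Ident_right_perp\<close> puts the identity of \<open>Z\<close> into the
  right perpendicular of \<open>I\<close>.\<close>

lemma special_precover_of_cokernel_Zero:
  assumes I: "cat_ideal C I" and ext: "closed_under_weak_extensions C WE I"
    and pc: "precover C I X p" "(p, c) \<in> WE" and c: "c \<in> Hom C X Z"
    and f: "Hom_special_precover C WE I Z f" and fT: "f \<in> Hom C T' Z"
  shows "f = Zero C T' Z"
proof -
  have pI: "p \<in> I" using pc(1) by (simp add: precover_def)
  have X: "X \<in> Ob C" using Hom_Ob c by blast
  have codp: "Cod C p = X" using pc(1) by (simp add: precover_def)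
  have codc: "Cod C c = Z" using HomD[OF c] by blast
  obtain T where p: "p \<in> Hom C T X" and cp: "c \<cdot> p = Zero C T Z"
    using WE_Hom[OF pc(2)] codp codc by auto
  obtain T'' Z' d where fd: "f \<in> I" "(f, d) \<in> WE" "f \<in> Hom C T'' Z"
    "d \<in> Hom C Z Z'" "d \<cdot> f = Zero C T'' Z'"
    using Hom_special_precoverE[OF f] by metis
  have TT: "T'' = T'" and domf: "Dom C f = T'" and codf: "Cod C f = Z" and codd: "Cod C d = Z'"
    using fd fT by (auto simp: Hom_def)
  have dc: "d \<cdot> c \<in> Hom C X Z'" using Comp_Hom c fd(4) by blast
  have "weak_deflation WE (d \<cdot> c)"
    by (rule weak_deflation_Comp)
      (use pc(2) fd(2) HomD[OF c] HomD[OF fd(4)] in \<open>auto simp: weak_deflation_def\<close>)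
  then obtain k where kWE: "(k, d \<cdot> c) \<in> WE" by (auto simp: weak_deflation_def)
  obtain Y where k: "k \<in> Hom C Y X" and dck: "(d \<cdot> c) \<cdot> k = Zero C Y Z'"
    using WE_Hom(1,3)[OF kWE] WE_Hom(2)[OF kWE, THEN HomD] HomD[OF dc] by simp
  have Y: "Dom C k = Y" "Cod C k = X" using HomD[OF k] by auto
  have ck: "c \<cdot> k \<in> Hom C Y Z" using Comp_Hom k c by blast
  have "d \<cdot> (c \<cdot> k) = Zero C Y Z'" using dck Comp_assoc[OF k c fd(4)] by simp
  \<comment> \<open>\<open>f\<close> is a weak kernel of \<open>d\<close>.\<close>
  then obtain l where l: "l \<in> Hom C Y T'" "c \<cdot> k = f \<cdot> l"
    using WE_kernel_factor[OF fd(2)] ck domf codf codd by metis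
  have ckI: "c \<cdot> k \<in> I" using l ideal_Comp_right[OF I fd(1) l(1) fT] by simp
  \<comment> \<open>The weak extension lives on the conflation \<open>(p, c)\<close>: take
    \<open>e2 = k\<close> and \<open>e1\<close> the identity of \<open>X\<close>, so that
    \<open>c \<cdot> e2 = c \<cdot> k\<close> and \<open>e1 \<cdot> p = p\<close>.\<close>
  have "k \<in> Hom C (Dom C k) (Cod C p)" "Ident C X \<in> Hom C (Cod C p) (Cod C k)"
    "k = Ident C X \<cdot> k" "Ident C X \<cdot> p = p"
    using Y k codp Ident_Hom[OF X] Comp_Ident_left[OF k] Comp_Ident_left[OF p] by simp_all
  then have "weak_extension C WE p (c \<cdot> k) k"
    unfolding weak_extension_def using pc(2) HomD[OF k] by blast
  then have "k \<in> I"
    using ext pI ckI by (auto simp: closed_under_weak_extensions_def diamond_def)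
  then obtain n where n: "n \<in> Hom C Y T" "k = p \<cdot> n"
    using precover_factor[OF pc(1) p _ k] by blast
  have "c \<cdot> k = Zero C T Z \<cdot> n"
    using Comp_assoc[OF n(1) p c] n(2) cp by simp
  also have "\<dots> = Zero C Y Z"
    using Comp_Zero_left[OF _ n(1)] Hom_Ob[OF c] by blast
  finally have "c \<cdot> k = Zero C Y Z" .
  \<comment> \<open>\<open>d \<cdot> c\<close> is a weak cokernel of \<open>k\<close>, and
    \<open>c\<close> kills \<open>k\<close>.\<close>
  then have "c \<in> Hom C (Cod C k) Z" "c \<cdot> k = Zero C (Dom C k) Z" "Cod C (d \<cdot> c) = Z'"
    using c Y HomD[OF dc] by simp_all
  then obtain h where h: "h \<in> Hom C Z' Z" "c = h \<cdot> d \<cdot> c"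
    using WE_cokernel_factor[OF kWE] by metis
  have hd: "h \<cdot> d \<in> Hom C Z Z" using Comp_Hom fd(4) h(1) by blast
  have "(h \<cdot> d) \<cdot> c = c"
    using Comp_assoc[OF c fd(4) h(1)] h(2) by (rule trans[OF _ sym])
  then have iso: "is_iso C (h \<cdot> d)"
    using WE_cokernel_endo_iso[OF pc(2)] hd codc by simp
  \<comment> \<open>The isomorphism \<open>h \<cdot> d\<close> can be cancelled on the left,
    although \<open>d\<close> alone need not be invertible.\<close>
  have "(h \<cdot> d) \<cdot> f = Zero C T' Z"
    using Comp_assoc[OF fT fd(4) h(1)] fd(5) TT Comp_Zero_right[OF _ h(1)] Hom_Ob[OF fT] by simp
  then show ?thesis using iso_Comp_Zero_imp_Zero[OF iso hd fT] by blast
qed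

end

theorem theorem38:
  fixes C :: "('o, 'm) acat" and WE :: "('m \<times> 'm) set" and I J :: "'m set"
  assumes "weak_exact_category C WE"
    and "complete_ideal_torsion_pair C WE I J"
    and "covering_ideal C I"
    and "closed_under_weak_extensions C WE I"
  shows "object_ideal C J"
proof -
  interpret weak_exact_category C WE by (rule assms(1))
  have I: "cat_ideal C I" and J: "cat_ideal C J" and JI: "J = right_perp C I"
    and special: "\<And>X. X \<in> Ob C \<Longrightarrow> \<exists>i. Hom_special_precover C WE I X i"
    using assms(2) unfolding complete_ideal_torsion_pair_def ideal_torsion_pair_def by blast+
  have "\<exists>Z \<in> Ob C. Ident C Z \<in> J \<and>
      (\<exists>g \<in> Hom C (Dom C j) Z. \<exists>h \<in> Hom C Z (Cod C j). j = Comp C h g)"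
    if jJ: "j \<in> J" for j
  proof -
    let ?X = "Dom C j"
    have j: "j \<in> Hom C ?X (Cod C j)" using jJ J HomI by (auto simp: cat_ideal_def)
    obtain p where "Hom_special_precover C WE I ?X p" using special Hom_Ob[OF j] by blast
    then obtain T Z c where p: "precover C I ?X p" "p \<in> I" "(p, c) \<in> WE"
      "p \<in> Hom C T ?X" "c \<in> Hom C ?X Z" "Comp C c p = Zero C T Z"
      using Hom_special_precoverE by metis
    have Z: "Z \<in> Ob C" using Hom_Ob p(5) by blast
    obtain f where f: "Hom_special_precover C WE I Z f" using special Z by blast
    then obtain T' where fT: "precover C I Z f" "f \<in> Hom C T' Z"
      using Hom_special_precoverE by metis
    have "f = Zero C T' Z"
      using special_precover_of_cokernel_Zero[OF I assms(4) p(1,3,5) f fT(2)] .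
    then have "Ident C Z \<in> J"
      using precover_Zero_imp_Ident_right_perp[OF I fT] JI by blast
    moreover have "Comp C j p = Zero C T (Cod C j)"
      using right_perp_Comp_Zero[OF _ p(2,4) j] jJ JI by blast
    then obtain h where "h \<in> Hom C Z (Cod C j)" "j = Comp C h c"
      using WE_cokernel_factor[OF p(3)] j HomD[OF p(4)] HomD[OF p(5)] by metis
    \<comment> \<open>The required object is \<open>Z\<close>, with \<open>c\<close> as first factor
      of \<open>j\<close> and \<open>h\<close> as second.\<close>
    ultimately show ?thesis using Z p(5) by blast
  qed
  then show ?thesis using J by (auto simp: object_ideal_def)
qed

end
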